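(* Let $k$ be a positive integer and let $G$ be a connected graph with $n \geq 6(k+1)(k+2)$ vertices such that $d_G(x) + d_G(y) \geq n + k$ for every edge $xy \in E(G)$. Then $G$ contains at least $\binom{k+1}{2}(n-k-1)+\binom{k+1}{3}$ triangles.
   Context: Graphs are finite and simple; $d_G(x)$ denotes the degree of the vertex $x$ in $G$. The number of triangles is the number of subgraphs of $G$ isomorphic to $K_3$. *)

theory Defs
  imports "Graph_Theory.Graph_Theory"
begin

text \<open>
  A finite simple graph is a symmetric digraph without loops and without parallel arcs
  (locale \<^locale>\<open>graph\<close>): an undirected edge \<open>xy\<close> is the pair of arcs \<open>x \<rightarrow> y\<close>, \<open>y \<rightarrow> x\<close>.
  The degree of \<open>x\<close> is therefore \<open>out_degree G x\<close> (each incident edge contributes exactly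
  one arc leaving \<open>x\<close>), as the following lemma confirms.
\<close>

lemma (in graph) out_degree_eq_card_neighbours:
  "out_degree G x = card {y. x \<rightarrow>\<^bsub>G\<^esub> y}"
proof -
  have "inj_on (head G) (out_arcs G x)"
    by (auto simp: inj_on_def out_arcs_def arc_to_ends_def intro: no_multi_arcs)
  moreover have "head G ` out_arcs G x = {y. x \<rightarrow>\<^bsub>G\<^esub> y}"
    by (auto simp: out_arcs_def arcs_ends_conv)
  ultimately show ?thesis
    by (metis card_image out_degree_def)
qed

text \<open>
  \<open>K\<^bsub>3\<^esub> H\<close> says that \<open>H\<close> is a complete graph on three vertices. A subgraph shares the
  maps \<open>tail\<close> and \<open>head\<close> with its host, so it is determined by its vertices and arcs,
  and every triangle occurs exactly once in this set.
\<close>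

definition triangles :: "('a, 'b) pre_digraph \<Rightarrow> ('a, 'b) pre_digraph set" where
  "triangles G = {H. subgraph H G \<and> K\<^bsub>3\<^esub> H}"

lemma (in graph) finite_triangles: "finite (triangles G)"
proof (rule finite_subset)
  show "triangles G \<subseteq> (\<lambda>(V, A). \<lparr>verts = V, arcs = A, tail = tail G, head = head G\<rparr>)
          ` (Pow (verts G) \<times> Pow (arcs G))"
  proof
    fix H assume "H \<in> triangles G"
    then have "verts H \<subseteq> verts G" "arcs H \<subseteq> arcs G" "tail H = tail G" "head H = head G"
      by (auto simp: triangles_def subgraph_def compatible_def)
    then show "H \<in> (\<lambda>(V, A). \<lparr>verts = V, arcs = A, tail = tail G, head = head G\<rparr>)
          ` (Pow (verts G) \<times> Pow (arcs G))"
      by (intro image_eqI[where x = "(verts H, arcs H)"]) auto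
  qed
qed auto

end

theory Submission
  imports Defs
begin

text \<open>
  The bound is sharp: in the join of \<open>K\<^bsub>k+1\<^esub>\<close> with an independent set every edge has
  degree sum at least \<open>n + k\<close>, and all triangles use at least two of the \<open>k + 1\<close> universal
  vertices. The proof finds a set of vertices that behaves like this core, unless all
  degrees are so large that plain counting suffices.

  Two adjacent vertices \<open>x\<close>, \<open>y\<close> have at least \<open>d(x) + d(y) - n \<ge> k\<close> common neighbours, so
  every edge lies in at least \<open>k\<close> triangles. Triangles are counted six times each, as
  ordered triples. If all degrees are at least \<open>3(k+1)\<close>, there are at least
  \<open>n \<cdot> 3(k+1) \<cdot> k\<close> such triples, which already exceeds six times the bound
  (\<open>ordered_triangles_of_large_min_degree\<close>).

  Otherwise some vertex \<open>v\<close> has degree \<open>d < 3(k+1)\<close>, and its neighbourhood \<open>A\<close> is the core: a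
  vertex of \<open>A\<close> has degree at least \<open>n + k - d\<close>, hence is adjacent to almost everything, and
  it has at least \<open>k\<close> neighbours within \<open>A\<close>. Counting only triangles with at least two
  vertices in \<open>A\<close> (\<open>ordered_triangles_of_nbh\<close>) gives at least
  \<open>d k (3n + 6k + 4 - 8d)\<close> ordered triples. Connectedness makes \<open>A\<close> nonempty, and as a
  neighbour of \<open>v\<close> has degree at most \<open>n - 1\<close>, it follows that \<open>d \<ge> k + 1\<close>. At \<open>d = k + 1\<close> the
  estimate equals six times the bound exactly, and for \<open>k + 1 \<le> d \<le> 3(k+1)\<close> it is at least
  as large, because it is concave in \<open>d\<close> and \<open>n\<close> is large (\<open>product_ge_at_left_end\<close>).
\<close>

section \<open>Triangles as ordered triples\<close>

context graph
begin

abbreviation nbh :: "'a \<Rightarrow> 'a set" where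
  "nbh x \<equiv> {y. x \<rightarrow> y}"

definition ordered_triangles :: "('a \<times> 'a \<times> 'a) set" where
  "ordered_triangles = {(x, y, z). x \<rightarrow> y \<and> y \<rightarrow> z \<and> x \<rightarrow> z}"

lemma dominates_sym: "x \<rightarrow> y \<longleftrightarrow> y \<rightarrow> x"
  by (blast intro: graph_symmetric)

lemma dominates_verts:
  assumes "x \<rightarrow> y" shows "x \<in> verts G" "y \<in> verts G"
  using assms by (auto dest: wellformed(1,2))

lemma dominates_irrefl: "\<not> x \<rightarrow> x"
  using no_loops by (auto simp: arcs_ends_conv)

lemma nbh_subset: "nbh x \<subseteq> verts G"
  by (auto dest: dominates_verts)

lemma finite_nbh [simp]: "finite (nbh x)"
  using nbh_subset finite_verts by (rule finite_subset)

lemma finite_ordered_triangles: "finite ordered_triangles"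
proof (rule finite_subset)
  show "ordered_triangles \<subseteq> verts G \<times> verts G \<times> verts G"
    by (auto simp: ordered_triangles_def dest: dominates_verts)
qed simp

text \<open>
  Three mutually adjacent vertices induce a \<open>K\<^bsub>3\<^esub>\<close>, and a three-element set has only six
  orderings.
\<close>

lemma card_ordered_triangles_le: "card ordered_triangles \<le> 6 * card (triangles G)"
proof -
  define F :: "('a, 'b) pre_digraph \<Rightarrow> ('a \<times> 'a \<times> 'a) set"
    where "F = (\<lambda>H. {(x, y, z). {x, y, z} = verts H})"
  have fibre: "finite (F H) \<and> card (F H) \<le> 6" if "H \<in> triangles G" for H
  proof -
    from that have "card (verts H) = 3" by (simp add: triangles_def complete_digraph_def)
    then obtain a b c where abc: "verts H = {a, b, c}" "a \<noteq> b" "b \<noteq> c" "a \<noteq> c"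
      by (auto simp: card_3_iff)
    let ?L = "[(a, b, c), (a, c, b), (b, a, c), (b, c, a), (c, a, b), (c, b, a)]"
    have sub: "F H \<subseteq> set ?L"
    proof
      fix t assume "t \<in> F H"
      then obtain x y z where t: "t = (x, y, z)" and eq: "{x, y, z} = {a, b, c}"
        by (auto simp: F_def abc(1))
      from eq have mem: "x \<in> {a, b, c}" "y \<in> {a, b, c}" "z \<in> {a, b, c}"
        "a \<in> {x, y, z}" "b \<in> {x, y, z}" "c \<in> {x, y, z}" by blast+
      then show "t \<in> set ?L" using abc(2-4) by (auto simp: t)
    qed
    have "card (F H) \<le> card (set ?L)" using sub by (rule card_mono[rotated]) simp
    also have "\<dots> \<le> 6" using card_length[of ?L] by simp
    finally show ?thesis using finite_subset[OF sub] by simp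
  qed
  have "ordered_triangles \<subseteq> (\<Union>H\<in>triangles G. F H)"
  proof
    fix t assume "t \<in> ordered_triangles"
    then obtain x y z where t: "t = (x, y, z)" and e: "x \<rightarrow> y" "y \<rightarrow> z" "x \<rightarrow> z"
      by (auto simp: ordered_triangles_def)
    let ?H = "G \<restriction> {x, y, z}"
    have ne: "x \<noteq> y" "y \<noteq> z" "x \<noteq> z" using e dominates_irrefl by auto
    have V: "{x, y, z} \<subseteq> verts G" using e dominates_verts by auto
    then have ind: "induced_subgraph ?H G" by (rule induced_induce)
    then have "digraph ?H" "sym_digraph ?H"
      by (rule digraphI_induced, rule induced_graph_imp_graph)
    then have "graph ?H"
      by (simp add: graph_def pseudo_graph_def digraph_def)
    moreover have "arcs_ends ?H = {(u, v). (u, v) \<in> verts ?H \<times> verts ?H \<and> u \<noteq> v}"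
    proof -
      have "arcs_ends ?H = {(u, v). u \<rightarrow> v \<and> u \<in> {x, y, z} \<and> v \<in> {x, y, z}}"
        by (auto simp: arcs_ends_conv image_iff)
      then show ?thesis
        using e dominates_sym dominates_irrefl by auto
    qed
    moreover have "card (verts ?H) = 3" using ne by simp
    ultimately have "?H \<in> triangles G"
      using induced_imp_subgraph[OF ind]
      unfolding triangles_def complete_digraph_def by blast
    then show "t \<in> (\<Union>H\<in>triangles G. F H)"
      by (rule UN_I) (simp add: F_def t)
  qed
  then have "card ordered_triangles \<le> card (\<Union>H\<in>triangles G. F H)"
    by (rule card_mono[rotated]) (simp add: finite_triangles fibre)
  also have "\<dots> \<le> (\<Sum>H\<in>triangles G. card (F H))"
    by (rule card_UN_le[OF finite_triangles])
  also have "\<dots> \<le> (\<Sum>H\<in>triangles G. 6)"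
    by (rule sum_mono) (simp add: fibre)
  finally show ?thesis by simp
qed

text \<open>
  An ordered pair \<open>(a, b)\<close> of adjacent vertices of \<open>A\<close> together with a common neighbour
  outside \<open>A\<close> yields three ordered triples, since the outside vertex can be put in any of
  the three positions; a common neighbour inside \<open>A\<close> yields only one, as the other
  placements are obtained from other pairs. For \<open>A = verts G\<close> this is the usual
  sum of codegrees over all arcs.
\<close>

lemma sum_pairs_le_card_ordered_triangles:
  assumes "A \<subseteq> verts G"
  shows "(\<Sum>a\<in>A. \<Sum>b\<in>nbh a \<inter> A. 3 * card (nbh a \<inter> nbh b - A) + card (nbh a \<inter> nbh b \<inter> A))
           \<le> card ordered_triangles"
proof -
  have finA: "finite A" using assms finite_verts by (rule finite_subset)
  define Out where "Out = (SIGMA a:A. SIGMA b:nbh a \<inter> A. nbh a \<inter> nbh b - A)"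
  define In where "In = (SIGMA a:A. SIGMA b:nbh a \<inter> A. nbh a \<inter> nbh b \<inter> A)"
  define Out2 where "Out2 = (\<lambda>(a, b, c). (a, c, b)) ` Out"
  define Out3 where "Out3 = (\<lambda>(a, b, c). (c, a, b)) ` Out"
  have card_Out: "card Out = (\<Sum>a\<in>A. \<Sum>b\<in>nbh a \<inter> A. card (nbh a \<inter> nbh b - A))"
    and card_In: "card In = (\<Sum>a\<in>A. \<Sum>b\<in>nbh a \<inter> A. card (nbh a \<inter> nbh b \<inter> A))"
    unfolding Out_def In_def using finA by (simp_all add: card_SigmaI)
  have fin: "finite Out" "finite In" "finite Out2" "finite Out3"
    unfolding Out2_def Out3_def Out_def In_def using finA by auto
  have card_Out23: "card Out2 = card Out" "card Out3 = card Out"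
    unfolding Out2_def Out3_def by (auto intro!: card_image simp: inj_on_def)
  have disj: "In \<inter> Out = {}" "(In \<union> Out) \<inter> Out2 = {}" "(In \<union> Out \<union> Out2) \<inter> Out3 = {}"
    by (auto simp: In_def Out_def Out2_def Out3_def)
  have sub: "In \<union> Out \<union> Out2 \<union> Out3 \<subseteq> ordered_triangles"
    by (auto simp: In_def Out_def Out2_def Out3_def ordered_triangles_def dominates_sym)
  have "(\<Sum>a\<in>A. \<Sum>b\<in>nbh a \<inter> A. 3 * card (nbh a \<inter> nbh b - A) + card (nbh a \<inter> nbh b \<inter> A))
      = 3 * card Out + card In"
    by (simp add: card_Out card_In sum.distrib sum_distrib_left)
  also have "\<dots> = card (In \<union> Out \<union> Out2 \<union> Out3)"
    using fin disj by (simp add: card_Un_disjoint card_Out23)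
  also have "\<dots> \<le> card ordered_triangles"
    using finite_ordered_triangles sub by (rule card_mono)
  finally show ?thesis .
qed

section \<open>Consequences of the degree condition\<close>

lemma card_common_nbh_ge:
  "card (nbh x) + card (nbh y) \<le> card (verts G) + card (nbh x \<inter> nbh y)"
proof -
  have "card (nbh x \<union> nbh y) \<le> card (verts G)"
    using nbh_subset by (intro card_mono) auto
  then show ?thesis using card_Un_Int[of "nbh x" "nbh y"] by simp
qed

lemma connected_imp_nbh_nonempty:
  assumes "Digraph_Component.connected G" "x \<in> verts G" "card (verts G) \<ge> 2"
  shows "nbh x \<noteq> {}"
proof -
  have "verts G \<noteq> {x}" using assms(3) by auto
  then obtain y where "y \<in> verts G" "x \<noteq> y" using assms(2) by blast
  then have "x \<rightarrow>\<^sup>*\<^bsub>with_proj (mk_symmetric G)\<^esub> y"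
    using assms(1,2) by (auto simp: connected_def strongly_connected_def mk_symmetric_def)
  then obtain z where "x \<rightarrow>\<^bsub>with_proj (mk_symmetric G)\<^esub> z"
    using \<open>x \<noteq> y\<close> by (cases rule: pre_digraph.converse_reachable_cases) auto
  then have "x \<rightarrow> z"
    using dominates_sym by (auto simp: mk_symmetric_def arcs_ends_conv)
  then show ?thesis by auto
qed

lemma ordered_triangles_of_large_min_degree:
  assumes edge: "\<And>x y. x \<rightarrow> y \<Longrightarrow> card (nbh x) + card (nbh y) \<ge> card (verts G) + k"
    and deg: "\<And>x. x \<in> verts G \<Longrightarrow> card (nbh x) \<ge> D"
  shows "card ordered_triangles \<ge> card (verts G) * (D * k)"
proof -
  have "card (verts G) * (D * k) = (\<Sum>a\<in>verts G. D * k)" by simp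
  also have "\<dots> \<le> (\<Sum>a\<in>verts G. card (nbh a) * k)"
    using deg by (intro sum_mono mult_le_mono1) auto
  also have "\<dots> = (\<Sum>a\<in>verts G. \<Sum>b\<in>nbh a \<inter> verts G. k)"
    by (simp add: Int_absorb2[OF nbh_subset])
  also have "\<dots> \<le> (\<Sum>a\<in>verts G. \<Sum>b\<in>nbh a \<inter> verts G.
      3 * card (nbh a \<inter> nbh b - verts G) + card (nbh a \<inter> nbh b \<inter> verts G))"
  proof (intro sum_mono)
    fix a b assume "b \<in> nbh a \<inter> verts G"
    then have "k \<le> card (nbh a \<inter> nbh b)"
      using edge[of a b] card_common_nbh_ge[of a b] by simp
    also have "nbh a \<inter> nbh b = nbh a \<inter> nbh b \<inter> verts G"
      using nbh_subset by blast
    finally show "k \<le> 3 * card (nbh a \<inter> nbh b - verts G) + card (nbh a \<inter> nbh b \<inter> verts G)"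
      by linarith
  qed
  also have "\<dots> \<le> card ordered_triangles"
    by (rule sum_pairs_le_card_ordered_triangles) simp
  finally show ?thesis .
qed

text \<open>
  Take \<open>A = nbh v\<close> and \<open>d = card A\<close>. Each \<open>a \<in> A\<close> has at least \<open>k\<close> neighbours in \<open>A\<close>, namely its
  common neighbours with \<open>v\<close>, so \<open>A\<close> spans at least \<open>d k\<close> ordered adjacent pairs. Such a pair
  has at least \<open>2(n + k - d) - n\<close> common neighbours, of which at most \<open>d - 2\<close> lie in \<open>A\<close>.
  Since an outer common neighbour counts three times and an inner one once, the pair
  contributes at least \<open>3(n + 2k - 2d) - 2(d - 2) = 3n + 6k + 4 - 8d\<close>. Treating the inner
  triangles this carefully keeps the estimate exact in the extremal case, where \<open>A\<close> is a
  clique of \<open>k + 1\<close> universal vertices.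
\<close>

lemma ordered_triangles_of_nbh:
  fixes k :: nat
  assumes edge: "\<And>x y. x \<rightarrow> y \<Longrightarrow> card (nbh x) + card (nbh y) \<ge> card (verts G) + k"
  shows "card ordered_triangles
           \<ge> card (nbh v) * k * (3 * card (verts G) + 6 * k + 4 - 8 * card (nbh v))"
proof -
  let ?A = "nbh v" and ?n = "card (verts G)"
  define d where "d = card ?A"
  define w where "w = 3 * ?n + 6 * k + 4 - 8 * d"
  have pairs: "k \<le> card (nbh a \<inter> ?A)" if "a \<in> ?A" for a
    using edge[of v a] card_common_nbh_ge[of a v] that by simp
  have weight: "w \<le> 3 * card (nbh a \<inter> nbh b - ?A) + card (nbh a \<inter> nbh b \<inter> ?A)"
    if a: "a \<in> ?A" and b: "b \<in> nbh a \<inter> ?A" for a b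
  proof -
    have "nbh a \<inter> nbh b \<inter> ?A \<subseteq> ?A - {a, b}"
      using dominates_irrefl by auto
    then have "card (nbh a \<inter> nbh b \<inter> ?A) \<le> card (?A - {a, b})"
      by (intro card_mono) auto
    moreover have "a \<noteq> b" using b dominates_irrefl by auto
    then have "card (?A - {a, b}) + 2 = d"
      using a b card_mono[of ?A "{a, b}"] by (simp add: card_Diff_subset d_def)
    ultimately have inner: "card (nbh a \<inter> nbh b \<inter> ?A) + 2 \<le> d" by simp
    have split: "card (nbh a \<inter> nbh b) = card (nbh a \<inter> nbh b - ?A) + card (nbh a \<inter> nbh b \<inter> ?A)"
      by (metis card_Diff_subset_Int card_Int_Diff finite_Int finite_nbh add.commute)
    have "?n + k \<le> d + card (nbh a)" "?n + k \<le> d + card (nbh b)"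
      using edge[of v a] edge[of v b] a b by (auto simp: d_def)
    then show ?thesis
      using inner split card_common_nbh_ge[of a b] unfolding w_def by linarith
  qed
  have "d * k * w = (\<Sum>a\<in>?A. k * w)" by (simp add: d_def)
  also have "\<dots> \<le> (\<Sum>a\<in>?A. card (nbh a \<inter> ?A) * w)"
    by (intro sum_mono mult_le_mono1 pairs)
  also have "\<dots> = (\<Sum>a\<in>?A. \<Sum>b\<in>nbh a \<inter> ?A. w)" by simp
  also have "\<dots> \<le> (\<Sum>a\<in>?A. \<Sum>b\<in>nbh a \<inter> ?A.
      3 * card (nbh a \<inter> nbh b - ?A) + card (nbh a \<inter> nbh b \<inter> ?A))"
    by (intro sum_mono weight)
  also have "\<dots> \<le> card ordered_triangles"
    by (rule sum_pairs_le_card_ordered_triangles[OF nbh_subset])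
  finally show ?thesis by (simp add: d_def w_def)
qed

end

section \<open>Comparison with the bound\<close>

text \<open>
  With \<open>K = k + 1\<close> and \<open>N = 3n + 6k + 4\<close> the right-hand side is \<open>k \<cdot> K (N - 8K)\<close>, which is
  the shape of the estimate for a neighbourhood of size \<open>K\<close>.
\<close>

lemma six_times_triangle_bound:
  fixes k n :: nat
  assumes "k < n"
  shows "6 * int ((k + 1 choose 2) * (n - k - 1) + (k + 1 choose 3))
           = int (k + 1) * int k * (3 * int n - 2 * int k - 4)"
proof -
  have c2: "2 * int (m choose 2) = int m * (int m - 1)" for m
    by (induction m) (auto simp: numeral_2_eq_2 algebra_simps)
  have c2': "2 * int (k + 1 choose 2) = (int k + 1) * int k"
    unfolding c2 by simp
  have "3 * (k + 1 choose 3) = (k + 1) * (k choose 2)"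
    using binomial_absorption[of 2 "k+1"] by (simp add: numeral_3_eq_3 numeral_2_eq_2)
  then have c3: "3 * int (k + 1 choose 3) = (int k + 1) * int (k choose 2)"
    by (metis of_nat_1 of_nat_add of_nat_mult of_nat_numeral)
  have nk: "int (n - k - 1) = int n - int k - 1" using assms by simp
  have "6 * int ((k + 1 choose 2) * (n - k - 1) + (k + 1 choose 3))
      = 3 * (2 * int (k + 1 choose 2)) * (int n - int k - 1) + 2 * (3 * int (k + 1 choose 3))"
    unfolding of_nat_add of_nat_mult nk by (simp add: algebra_simps)
  also have "\<dots> = 3 * ((int k + 1) * int k) * (int n - int k - 1) + (int k + 1) * (2 * int (k choose 2))"
    unfolding c3 c2' by algebra
  also have "\<dots> = int (k + 1) * int k * (3 * int n - 2 * int k - 4)"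
    unfolding c2 by (simp add: algebra_simps)
  finally show ?thesis .
qed

text \<open>
  A concave quadratic stays above its value at \<open>K\<close> up to the reflection of \<open>K\<close> in its axis, which
  is the point \<open>N/8 - K \<ge> 3K\<close>. This is where \<open>n\<close> has to be large compared with \<open>k\<close>.
\<close>

lemma product_ge_at_left_end:
  fixes d K N :: int
  assumes "K \<le> d" "d \<le> 3 * K" "32 * K \<le> N"
  shows "K * (N - 8 * K) \<le> d * (N - 8 * d)"
proof -
  have "0 \<le> (d - K) * (N - 8 * (d + K))"
    using assms by (intro mult_nonneg_nonneg) auto
  also have "\<dots> = d * (N - 8 * d) - K * (N - 8 * K)"
    by (simp add: algebra_simps)
  finally show ?thesis by simp
qed

theorem theorem6:
  fixes G :: "('a, 'b) pre_digraph" and k n :: nat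
  assumes "k > 0"
    and "graph G"
    and "Digraph_Component.connected G"
    and "card (verts G) = n"
    and "n \<ge> 6 * (k + 1) * (k + 2)"
    and "\<And>x y. x \<rightarrow>\<^bsub>G\<^esub> y \<Longrightarrow> out_degree G x + out_degree G y \<ge> n + k"
  shows "card (triangles G) \<ge> ((k + 1) choose 2) * (n - k - 1) + ((k + 1) choose 3)"
proof -
  interpret graph G by fact
  let ?t = "(k + 1 choose 2) * (n - k - 1) + (k + 1 choose 3)"
  have n_large: "18 * (k + 1) \<le> n"
  proof -
    have "6 * (k + 1) * 3 \<le> 6 * (k + 1) * (k + 2)"
      using \<open>k > 0\<close> by (intro mult_le_mono2) simp
    then show ?thesis using assms(5) by linarith
  qed
  then have target: "6 * int ?t = int (k + 1) * int k * (3 * int n - 2 * int k - 4)"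
    by (intro six_times_triangle_bound) simp
  have edge: "card (verts G) + k \<le> card (nbh x) + card (nbh y)" if "x \<rightarrow>\<^bsub>G\<^esub> y" for x y
    using assms(6)[OF that] assms(4) by (simp add: out_degree_eq_card_neighbours)
  have "6 * int ?t \<le> int (card ordered_triangles)"
  proof (cases "\<forall>x\<in>verts G. 3 * (k + 1) \<le> card (nbh x)")
    case True
    have "6 * int ?t \<le> int (k + 1) * int k * (3 * int n)"
      unfolding target by (intro mult_left_mono) auto
    also have "\<dots> = int (n * (3 * (k + 1) * k))" by (simp add: algebra_simps)
    also have "\<dots> \<le> int (card ordered_triangles)"
      using ordered_triangles_of_large_min_degree[OF edge, of "3 * (k + 1)"] True assms(4)
      by (simp only: of_nat_le_iff)
    finally show ?thesis .
  next
    case False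
    then obtain v where v: "v \<in> verts G" "card (nbh v) < 3 * (k + 1)" by auto
    define d where "d = card (nbh v)"
    have "nbh v \<noteq> {}"
      using assms(3,4) v(1) n_large by (intro connected_imp_nbh_nonempty) auto
    then obtain u where u: "v \<rightarrow>\<^bsub>G\<^esub> u" by auto
    have "nbh u \<subset> verts G"
      using nbh_subset[of u] dominates_irrefl[of u] dominates_verts(2)[OF u] by blast
    then have "card (nbh u) < n"
      using psubset_card_mono[OF finite_verts] assms(4) by blast
    then have d_ge: "k + 1 \<le> d" using edge[OF u] assms(4) by (simp add: d_def)
    have large: "8 * d \<le> 3 * n + 6 * k + 4" using v(2) n_large by (simp add: d_def)
    \<comment> \<open>Six times the bound is the value at \<open>d = k + 1\<close> of the estimate for \<open>nbh v\<close>.\<close>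
    have "6 * int ?t = int k * (int (k + 1) * ((3 * int n + 6 * int k + 4) - 8 * int (k + 1)))"
      unfolding target by (simp add: algebra_simps)
    also have "\<dots> \<le> int k * (int d * ((3 * int n + 6 * int k + 4) - 8 * int d))"
      using d_ge v(2) n_large
      by (intro mult_left_mono product_ge_at_left_end) (auto simp: d_def)
    also have "\<dots> = int (d * k * (3 * n + 6 * k + 4 - 8 * d))"
      unfolding of_nat_mult of_nat_diff[OF large] by (simp add: algebra_simps)
    also have "\<dots> \<le> int (card ordered_triangles)"
      using ordered_triangles_of_nbh[OF edge, of v] assms(4)
      by (simp only: of_nat_le_iff d_def)
    finally show ?thesis .
  qed
  also have "\<dots> \<le> int (6 * card (triangles G))"
    using card_ordered_triangles_le by (simp only: of_nat_le_iff)
  finally have "6 * int ?t \<le> int (6 * card (triangles G))" .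
  moreover have "a \<le> b" if "6 * int a \<le> int (6 * b)" for a b :: nat
    using that by simp
  ultimately show ?thesis by blast
qed

end
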